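(* Let $k\geq 1$ be an integer and let $c\geq 1$ be a real number. There exists a constant $C>0$ depending only on $k$ and $c$ such that the following holds. For any integer $m\geq 1$, any proper generalized arithmetic progression $B\subset A=\mathbb{Z}/m\mathbb{Z}$ of dimension $k$ such that $|B|\geq\sqrt{m}$, and any function $\varphi:A\to\mathbb{C}$ satisfying Condition $\mathcal{H}(c)$, we have $$\Bigl|\sum_{x\in B}\varphi(x)\Bigr|\leq C\,|B|^{1-1/(k+2)}m^{1/(2(k+2))}=C\,|B|\Bigl(\frac{\sqrt{m}}{|B|}\Bigr)^{1/(k+2)}.$$
   Context: Condition $\mathcal{H}(c)$: for a finite abelian group $A$, $\varphi:A\to\mathbb{C}$ and a real number $c\geq1$, $\varphi$ satisfies $\mathcal{H}(c)$ if (i) $\|\varphi\|_\infty=\max_{x\in A}|\varphi(x)|\leq c$; and (ii) there exists a subset $D\subset A$ with $|D|\leq c$ such that $|\mathcal{C}(\varphi,a)|\leq c\sqrt{|A|}$ for all $a\in A\setminus D$, where $\mathcal{C}(\varphi,a)=\sum_{x\in A}\varphi(x)\overline{\varphi(x+a)}$. A proper generalized arithmetic progression of dimension $k$ in a finite abelian group $A$ is a set $B$ of all elements of the form $b=a_0+n_1a_1+\cdots+n_ka_k$, where $(a_0,\ldots,a_k)\in A^{k+1}$ is fixed and each $n_i$ ranges over an interval $I_i$ of (consecutive) integers of length $|I_i|\geq 2$ (number of elements), such that the representation of any $b\in B$ in this form is unique. *)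

theory Defs
  imports Complex_Main "HOL-Algebra.Elementary_Groups" "HOL-Algebra.FiniteProduct"
begin

text \<open>
  Finite abelian groups are HOL-Algebra groups, written multiplicatively: for the library group
  \<^const>\<open>integer_mod_group\<close>, the operation is addition modulo \<open>m\<close> on \<open>{0..<m}\<close>
  and the power \<open>a [^] n\<close> is the multiple \<open>n a\<close>.  The definitions below are
  intended for groups with finite carrier, and depend on \<open>\<phi>\<close> only through its values
  on the carrier.
\<close>

definition correlation :: "('a, 'b) monoid_scheme \<Rightarrow> ('a \<Rightarrow> complex) \<Rightarrow> 'a \<Rightarrow> complex"
  where "correlation A \<phi> a = (\<Sum>x\<in>carrier A. \<phi> x * cnj (\<phi> (x \<otimes>\<^bsub>A\<^esub> a)))"

definition condition_H :: "('a, 'b) monoid_scheme \<Rightarrow> real \<Rightarrow> ('a \<Rightarrow> complex) \<Rightarrow> bool"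
  where "condition_H A c \<phi> \<longleftrightarrow>
    Max ((\<lambda>x. cmod (\<phi> x)) ` carrier A) \<le> c \<and>
    (\<exists>D. D \<subseteq> carrier A \<and> real (card D) \<le> c \<and>
      (\<forall>a \<in> carrier A - D. cmod (correlation A \<phi> a) \<le> c * sqrt (real (order A))))"

definition gap_elem :: "('a, 'b) monoid_scheme \<Rightarrow> nat \<Rightarrow> (nat \<Rightarrow> 'a) \<Rightarrow> (nat \<Rightarrow> int) \<Rightarrow> 'a"
  where "gap_elem A k a n = a 0 \<otimes>\<^bsub>A\<^esub> (\<Otimes>\<^bsub>A\<^esub>i\<in>{1..k}. a i [^]\<^bsub>A\<^esub> n i)"

text \<open>
  Tuples \<open>(n\<^sub>1, \<dots>, n\<^sub>k)\<close> are extensional functions on \<open>{1..k}\<close>, so that injectivity on the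
  extensional product of the intervals says exactly that representations are unique.
\<close>

definition proper_gap :: "('a, 'b) monoid_scheme \<Rightarrow> nat \<Rightarrow> 'a set \<Rightarrow> bool"
  where "proper_gap A k B \<longleftrightarrow>
    (\<exists>(a :: nat \<Rightarrow> 'a) (l :: nat \<Rightarrow> int) (u :: nat \<Rightarrow> int).
      (\<forall>i\<in>{0..k}. a i \<in> carrier A) \<and>
      (\<forall>i\<in>{1..k}. card {l i..u i} \<ge> 2) \<and>
      B = gap_elem A k a ` (\<Pi>\<^sub>E i\<in>{1..k}. {l i..u i}) \<and>
      inj_on (gap_elem A k a) (\<Pi>\<^sub>E i\<in>{1..k}. {l i..u i}))"

end

theory Submission
  imports Defs
begin

text \<open>
  Let \<open>S\<close> be the sum over \<open>B\<close> and \<open>S\<^sub>x\<close> the sum over the translate of \<open>B\<close> by \<open>x\<close>.  Expanding the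
  square and using the correlation bounds, the second moment of \<open>S\<^sub>x\<close> over all \<open>x\<close> is at most
  \<open>2c\<^sup>3|B|\<^sup>2\<surd>|A|\<close>.  On the other hand, a translation by \<open>t\<^sub>1a\<^sub>1 + \<dots> + t\<^sub>ka\<^sub>k\<close> with
  \<open>0 \<le> t\<^sub>i < \<epsilon>|I\<^sub>i|\<close> changes \<open>S\<close> by at most \<open>2ck\<epsilon>|B|\<close>, and there are at least \<open>\<epsilon>\<^sup>k|B|\<close> such
  translations.  With \<open>\<epsilon> = |S|/(4ck|B|)\<close> they all satisfy \<open>|S\<^sub>x| \<ge> |S|/2\<close>, and comparison with
  the second moment gives \<open>(|S|/|B|)\<^sup>k\<^sup>+\<^sup>2 = O(\<surd>|A|/|B|)\<close>.
\<close>

section \<open>Correlations and the second moment of translated sums\<close>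

lemma condition_HD:
  assumes "condition_H A c \<phi>" "finite (carrier A)"
  shows "x \<in> carrier A \<Longrightarrow> cmod (\<phi> x) \<le> c"
    and "\<exists>D. D \<subseteq> carrier A \<and> real (card D) \<le> c \<and>
      (\<forall>a \<in> carrier A - D. cmod (correlation A \<phi> a) \<le> c * sqrt (real (order A)))"
proof -
  show "cmod (\<phi> x) \<le> c" if "x \<in> carrier A"
  proof -
    have "cmod (\<phi> x) \<le> Max ((\<lambda>x. cmod (\<phi> x)) ` carrier A)"
      using assms(2) that by (intro Max_ge) auto
    then show ?thesis
      using assms(1) by (simp add: condition_H_def)
  qed
qed (use assms(1) in \<open>simp add: condition_H_def\<close>)

text \<open>The trivial bound, for the at most \<open>c\<close> exceptional shifts in
  \<open>D\<close>, where \<open>condition_H\<close> gives no square-root saving.\<close>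

lemma norm_correlation_le:
  assumes "group A" "a \<in> carrier A" and le: "\<And>x. x \<in> carrier A \<Longrightarrow> cmod (\<phi> x) \<le> c"
  shows "cmod (correlation A \<phi> a) \<le> c\<^sup>2 * real (order A)"
proof -
  interpret group A by fact
  have "cmod (correlation A \<phi> a) \<le> (\<Sum>x\<in>carrier A. c * c)"
    unfolding correlation_def
  proof (rule sum_norm_le)
    fix x assume "x \<in> carrier A"
    then have "cmod (\<phi> x) \<le> c" "cmod (\<phi> (x \<otimes>\<^bsub>A\<^esub> a)) \<le> c"
      using le assms(2) by auto
    then have "cmod (\<phi> x) * cmod (\<phi> (x \<otimes>\<^bsub>A\<^esub> a)) \<le> c * c"
      by (intro mult_mono) (auto intro: order_trans[OF norm_ge_zero])
    then show "cmod (\<phi> x * cnj (\<phi> (x \<otimes>\<^bsub>A\<^esub> a))) \<le> c * c"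
      by (simp add: norm_mult)
  qed
  then show ?thesis
    by (simp add: order_def power2_eq_square mult.commute)
qed

text \<open>The substitution \<open>y = b \<otimes> x\<close> leaves a shift that depends only on
  the quotient of \<open>b'\<close> by \<open>b\<close>.\<close>

lemma (in comm_group) sum_translate_eq_correlation:
  assumes "b \<in> carrier G" "b' \<in> carrier G"
  shows "(\<Sum>x\<in>carrier G. \<phi> (b \<otimes> x) * cnj (\<phi> (b' \<otimes> x))) = correlation G \<phi> (b' \<otimes> inv b)"
  unfolding correlation_def
proof (rule sum.reindex_bij_witness[where i = "\<lambda>y. inv b \<otimes> y" and j = "\<lambda>x. b \<otimes> x"])
  fix x assume x: "x \<in> carrier G"
  have "b \<otimes> x \<otimes> (b' \<otimes> inv b) = b' \<otimes> x"
    using assms x by (simp add: m_ac) (metis m_assoc m_comm inv_closed r_inv r_one m_closed)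
  then show "\<phi> (b \<otimes> x) * cnj (\<phi> (b \<otimes> x \<otimes> (b' \<otimes> inv b))) = \<phi> (b \<otimes> x) * cnj (\<phi> (b' \<otimes> x))"
    by simp
next
  fix x assume "x \<in> carrier G"
  then show "inv b \<otimes> (b \<otimes> x) = x" "b \<otimes> (inv b \<otimes> x) = x"
    using assms m_assoc[of "inv b" b x] m_assoc[of b "inv b" x] by simp_all
qed (use assms in simp_all)

lemma (in comm_group) second_moment_translates:
  assumes "finite (carrier G)" "B \<subseteq> carrier G"
  shows "complex_of_real (\<Sum>x\<in>carrier G. (cmod (\<Sum>b\<in>B. \<phi> (b \<otimes> x)))\<^sup>2)
    = (\<Sum>b\<in>B. \<Sum>b'\<in>B. correlation G \<phi> (b' \<otimes> inv b))"
proof -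
  have "complex_of_real (\<Sum>x\<in>carrier G. (cmod (\<Sum>b\<in>B. \<phi> (b \<otimes> x)))\<^sup>2)
    = (\<Sum>x\<in>carrier G. \<Sum>b\<in>B. \<Sum>b'\<in>B. \<phi> (b \<otimes> x) * cnj (\<phi> (b' \<otimes> x)))"
    by (simp only: of_real_sum complex_norm_square cnj_sum sum_product)
  also have "\<dots> = (\<Sum>b\<in>B. \<Sum>x\<in>carrier G. \<Sum>b'\<in>B. \<phi> (b \<otimes> x) * cnj (\<phi> (b' \<otimes> x)))"
    by (rule sum.swap)
  also have "\<dots> = (\<Sum>b\<in>B. \<Sum>b'\<in>B. \<Sum>x\<in>carrier G. \<phi> (b \<otimes> x) * cnj (\<phi> (b' \<otimes> x)))"
    by (intro sum.cong refl sum.swap)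
  also have "\<dots> = (\<Sum>b\<in>B. \<Sum>b'\<in>B. correlation G \<phi> (b' \<otimes> inv b))"
    using assms by (intro sum.cong refl sum_translate_eq_correlation) auto
  finally show ?thesis .
qed

text \<open>For fixed \<open>b\<close>, the map \<open>b' \<mapsto> b' \<otimes> inv b\<close> is
  injective, so at most \<open>c\<close> elements \<open>b'\<close> meet the exceptional set. They
  get the trivial bound, all others the square-root bound, and each group contributes at most
  \<open>c ^ 3 * ?N * sqrt ?m\<close>. Summing over \<open>b\<close> gives one more factor
  \<open>?N\<close>.\<close>

lemma (in comm_group) second_moment_translates_le:
  assumes fin: "finite (carrier G)" and B: "B \<subseteq> carrier G"
    and H: "condition_H G c \<phi>" and c: "c \<ge> 1" and large: "sqrt (real (order G)) \<le> real (card B)"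
  shows "(\<Sum>x\<in>carrier G. (cmod (\<Sum>b\<in>B. \<phi> (b \<otimes> x)))\<^sup>2)
    \<le> 2 * c ^ 3 * (real (card B))\<^sup>2 * sqrt (real (order G))"
proof -
  let ?m = "real (order G)" and ?N = "real (card B)"
  obtain D where D: "D \<subseteq> carrier G" "real (card D) \<le> c"
      "\<And>a. a \<in> carrier G - D \<Longrightarrow> cmod (correlation G \<phi> a) \<le> c * sqrt ?m"
    using condition_HD(2)[OF H fin] by blast
  have finB: "finite B" and finD: "finite D"
    using fin B D(1) finite_subset by auto
  have inner: "cmod (\<Sum>b'\<in>B. correlation G \<phi> (b' \<otimes> inv b)) \<le> 2 * c ^ 3 * ?N * sqrt ?m"
    if b: "b \<in> B" for b
  proof -
    have bc: "b \<in> carrier G"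
      using b B by auto
    let ?E = "{b' \<in> B. b' \<otimes> inv b \<in> D}"
    have "inj_on (\<lambda>b'. b' \<otimes> inv b) ?E"
      by (rule inj_onI) (use B bc in \<open>auto simp: subset_iff\<close>)
    then have "card ?E \<le> card D"
      by (rule card_inj_on_le) (use finD in auto)
    then have cE: "real (card ?E) \<le> c"
      using D(2) by linarith
    \<comment> \<open>The term \<open>c * sqrt ?m\<close> is granted to exceptional
      \<open>b'\<close> as well, so the majorant splits into two sums without a complement.\<close>
    have "cmod (\<Sum>b'\<in>B. correlation G \<phi> (b' \<otimes> inv b))
        \<le> (\<Sum>b'\<in>B. (if b' \<in> ?E then c\<^sup>2 * ?m else 0) + c * sqrt ?m)"
    proof (rule sum_norm_le)
      fix b' assume b': "b' \<in> B"
      then have "b' \<otimes> inv b \<in> carrier G"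
        using B bc by auto
      moreover from this have "cmod (correlation G \<phi> (b' \<otimes> inv b)) \<le> c\<^sup>2 * ?m"
        by (intro norm_correlation_le is_group condition_HD(1)[OF H fin])
      moreover have "0 \<le> c * sqrt ?m"
        using c by simp
      ultimately show "cmod (correlation G \<phi> (b' \<otimes> inv b))
          \<le> (if b' \<in> ?E then c\<^sup>2 * ?m else 0) + c * sqrt ?m"
        using D(3)[of "b' \<otimes> inv b"] b' by auto
    qed
    also have "\<dots> = (\<Sum>b'\<in>?E. c\<^sup>2 * ?m) + ?N * (c * sqrt ?m)"
      using finB by (simp add: sum.distrib sum.inter_filter[symmetric])
    also have "\<dots> = real (card ?E) * (c\<^sup>2 * ?m) + ?N * (c * sqrt ?m)"
      by simp
    also have "\<dots> \<le> c * (c\<^sup>2 * (?N * sqrt ?m)) + ?N * (c ^ 3 * sqrt ?m)"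
    proof (rule add_mono)
      \<comment> \<open>Here the size of \<open>B\<close> pays for the exceptional terms: the
        trivial bound \<open>?m\<close> is traded for \<open>?N * sqrt ?m\<close>.\<close>
      have "sqrt ?m * sqrt ?m \<le> ?N * sqrt ?m"
        by (rule mult_right_mono[OF large]) simp
      then have "?m \<le> ?N * sqrt ?m"
        by simp
      then show "real (card ?E) * (c\<^sup>2 * ?m) \<le> c * (c\<^sup>2 * (?N * sqrt ?m))"
        using cE c by (intro mult_mono mult_left_mono) auto
      have "c ^ 1 \<le> c ^ 3"
        using c by (intro power_increasing) auto
      then show "?N * (c * sqrt ?m) \<le> ?N * (c ^ 3 * sqrt ?m)"
        by (intro mult_left_mono mult_right_mono) auto
    qed
    also have "\<dots> = 2 * c ^ 3 * ?N * sqrt ?m"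
      by (simp add: power2_eq_square power3_eq_cube)
    finally show ?thesis .
  qed
  \<comment> \<open>The identity for the second moment lives in the complex numbers; the moment,
    being real and nonnegative, is the norm of its embedding.\<close>
  have "(\<Sum>x\<in>carrier G. (cmod (\<Sum>b\<in>B. \<phi> (b \<otimes> x)))\<^sup>2)
      = cmod (complex_of_real (\<Sum>x\<in>carrier G. (cmod (\<Sum>b\<in>B. \<phi> (b \<otimes> x)))\<^sup>2))"
    by (subst norm_of_real) (simp add: sum_nonneg)
  also have "\<dots> = cmod (\<Sum>b\<in>B. \<Sum>b'\<in>B. correlation G \<phi> (b' \<otimes> inv b))"
    by (simp only: second_moment_translates[OF fin B])
  also have "\<dots> \<le> (\<Sum>b\<in>B. 2 * c ^ 3 * ?N * sqrt ?m)"
    by (rule sum_norm_le) (rule inner)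
  also have "\<dots> = 2 * c ^ 3 * ?N\<^sup>2 * sqrt ?m"
    by (simp add: power2_eq_square)
  finally show ?thesis .
qed

section \<open>Translating a progression along its own steps\<close>

lemma norm_sum_diff_le_card_Diff:
  fixes f :: "'a \<Rightarrow> 'b::real_normed_vector"
  assumes fin: "finite X" "finite Y" and card: "card X = card Y"
    and le: "\<And>x. x \<in> X \<union> Y \<Longrightarrow> norm (f x) \<le> c"
  shows "norm (sum f X - sum f Y) \<le> 2 * c * real (card (Y - X))"
proof -
  \<comment> \<open>The common part cancels in the difference, and equal cardinalities let one count
    serve for both remaining pieces.\<close>
  have "card (X - Y) = card (Y - X)"
    using fin card by (simp add: card_Diff_subset_Int Int_commute)
  moreover have "sum f X - sum f Y = sum f (X - Y) - sum f (Y - X)"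
    using sum.Int_Diff[OF fin(1), of f Y] sum.Int_Diff[OF fin(2), of f X]
    by (simp add: Int_commute)
  moreover have "norm (sum f (X - Y)) \<le> real (card (X - Y)) * c"
    by (rule order_trans[OF sum_norm_bound[of _ _ c]]) (use le in auto)
  moreover have "norm (sum f (Y - X)) \<le> real (card (Y - X)) * c"
    by (rule order_trans[OF sum_norm_bound[of _ _ c]]) (use le in auto)
  ultimately show ?thesis
    using norm_triangle_ineq4[of "sum f (X - Y)" "sum f (Y - X)"] by (simp add: mult.commute)
qed

definition gap_shift :: "('a, 'b) monoid_scheme \<Rightarrow> nat \<Rightarrow> (nat \<Rightarrow> 'a) \<Rightarrow> (nat \<Rightarrow> int) \<Rightarrow> 'a"
  where "gap_shift A k a t = (\<Otimes>\<^bsub>A\<^esub>i\<in>{1..k}. a i [^]\<^bsub>A\<^esub> t i)"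

lemma (in comm_group) gap_shift_closed:
  assumes "\<forall>i\<in>{0..k}. a i \<in> carrier G"
  shows "gap_shift G k a t \<in> carrier G"
  unfolding gap_shift_def by (rule finprod_closed) (use assms in auto)

lemma (in comm_group) gap_elem_closed:
  assumes "\<forall>i\<in>{0..k}. a i \<in> carrier G"
  shows "gap_elem G k a n \<in> carrier G"
  using gap_shift_closed[OF assms, of n] assms by (auto simp: gap_elem_def gap_shift_def)

text \<open>Turns translation in the group into addition of index tuples, so that translates of a
  progression are studied through integer boxes. The restriction keeps the sum extensional, as
  membership in a box requires.\<close>

lemma (in comm_group) gap_elem_add:
  assumes "\<forall>i\<in>{0..k}. a i \<in> carrier G"
  shows "gap_elem G k a (\<lambda>i\<in>{1..k}. n i + t i) = gap_elem G k a n \<otimes> gap_shift G k a t"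
proof -
  have "(\<Otimes>i\<in>{1..k}. a i [^] (\<lambda>i\<in>{1..k}. n i + t i) i) = (\<Otimes>i\<in>{1..k}. a i [^] n i \<otimes> a i [^] t i)"
    by (rule finprod_cong') (use assms in \<open>auto simp: int_pow_mult\<close>)
  also have "\<dots> = (\<Otimes>i\<in>{1..k}. a i [^] n i) \<otimes> (\<Otimes>i\<in>{1..k}. a i [^] t i)"
    by (rule finprod_multf) (use assms in auto)
  finally have "gap_elem G k a (\<lambda>i\<in>{1..k}. n i + t i)
      = a 0 \<otimes> (gap_shift G k a n \<otimes> gap_shift G k a t)"
    by (simp add: gap_elem_def gap_shift_def)
  also have "\<dots> = a 0 \<otimes> gap_shift G k a n \<otimes> gap_shift G k a t"
    using assms gap_shift_closed[OF assms] by (intro m_assoc[symmetric]) auto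
  finally show ?thesis
    by (simp add: gap_elem_def gap_shift_def)
qed

text \<open>As \<open>t\<close> is nonnegative, a tuple leaves the box only by having some
  coordinate \<open>i\<close> among the top \<open>t i\<close> values of its interval. Such a slab
  makes up at most a proportion \<open>\<epsilon>\<close> of the box, and a union bound over
  \<open>i\<close> finishes.\<close>

lemma card_box_translate_Diff_le:
  fixes l u t :: "nat \<Rightarrow> int"
  assumes fin: "finite I" and \<epsilon>: "\<And>i. i \<in> I \<Longrightarrow> 0 \<le> t i \<and> real_of_int (t i) \<le> \<epsilon> * real (card {l i..u i})"
  shows "real (card {n \<in> \<Pi>\<^sub>E i\<in>I. {l i..u i}. (\<lambda>i\<in>I. n i + t i) \<notin> (\<Pi>\<^sub>E i\<in>I. {l i..u i})})
    \<le> real (card I) * \<epsilon> * real (card (\<Pi>\<^sub>E i\<in>I. {l i..u i}))"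
proof -
  let ?P = "\<Pi>\<^sub>E i\<in>I. {l i..u i}"
  \<comment> \<open>The half-open side contains exactly \<open>t i\<close> integers. It may reach
    below \<open>l i\<close>, which is harmless since the slabs only have to cover.\<close>
  let ?Q = "\<lambda>i. \<Pi>\<^sub>E j\<in>I. if j = i then {u i - t i <..u i} else {l j..u j}"
  have sub: "{n \<in> ?P. (\<lambda>i\<in>I. n i + t i) \<notin> ?P} \<subseteq> (\<Union>i\<in>I. ?Q i)"
  proof
    fix n assume "n \<in> {n \<in> ?P. (\<lambda>i\<in>I. n i + t i) \<notin> ?P}"
    then have n: "n \<in> ?P" and "(\<lambda>i\<in>I. n i + t i) \<notin> ?P"
      by auto
    then obtain i where i: "i \<in> I" "n i + t i \<notin> {l i..u i}"
      by (auto simp: PiE_iff)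
    have ni: "l i \<le> n i" "n i \<le> u i"
      using n i(1) by (auto simp: PiE_iff)
    then have "n i + t i > u i"
      using i \<epsilon>[OF i(1)] by auto
    then have "n \<in> ?Q i"
      using n ni by (auto simp: PiE_iff)
    then show "n \<in> (\<Union>i\<in>I. ?Q i)"
      using i(1) by blast
  qed
  have finQ: "finite (?Q i)" for i
    using fin by (intro finite_PiE) auto
  have "card {n \<in> ?P. (\<lambda>i\<in>I. n i + t i) \<notin> ?P} \<le> card (\<Union>i\<in>I. ?Q i)"
    by (rule card_mono[OF _ sub]) (use fin finQ in auto)
  also have "\<dots> \<le> (\<Sum>i\<in>I. card (?Q i))"
    by (rule card_UN_le[OF fin])
  finally have "real (card {n \<in> ?P. (\<lambda>i\<in>I. n i + t i) \<notin> ?P}) \<le> (\<Sum>i\<in>I. real (card (?Q i)))"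
    unfolding of_nat_sum[symmetric] of_nat_le_iff .
  also have "\<dots> \<le> (\<Sum>i\<in>I. \<epsilon> * real (card ?P))"
  proof (rule sum_mono)
    fix i assume i: "i \<in> I"
    let ?R = "\<Prod>j\<in>I - {i}. card {l j..u j}"
    have "card (?Q i) = (\<Prod>j\<in>I. card (if j = i then {u i - t i <..u i} else {l j..u j}))"
      by (rule card_PiE[OF fin])
    also have "\<dots> = nat (t i) * ?R"
      using \<epsilon>[OF i] by (subst prod.remove[OF fin i]) (simp cong: prod.cong_simp)
    finally have "real (card (?Q i)) = real_of_int (t i) * real ?R"
      using \<epsilon>[OF i] by simp
    also have "\<dots> \<le> \<epsilon> * real (card {l i..u i}) * real ?R"
      using \<epsilon>[OF i] by (intro mult_right_mono of_nat_0_le_iff) auto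
    also have "\<dots> = \<epsilon> * real (card ?P)"
      by (simp only: card_PiE[OF fin] prod.remove[OF fin i] of_nat_mult mult.assoc)
    finally show "real (card (?Q i)) \<le> \<epsilon> * real (card ?P)" .
  qed
  finally show ?thesis
    by simp
qed

text \<open>An element of the translate outside \<open>B\<close> comes from an index tuple that
  \<open>t\<close> pushes out of the box, so the box count bounds the symmetric difference. Only
  this inclusion holds in general: a tuple outside the box may still represent an element of
  \<open>B\<close>.\<close>

lemma (in comm_group) norm_gap_sum_translate_diff_le:
  assumes fin: "finite (carrier G)" and a: "\<forall>i\<in>{0..k}. a i \<in> carrier G"
    and B: "B = gap_elem G k a ` (\<Pi>\<^sub>E i\<in>{1..k}. {l i..u i})"
    and inj: "inj_on (gap_elem G k a) (\<Pi>\<^sub>E i\<in>{1..k}. {l i..u i})"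
    and t: "\<And>i. i \<in> {1..k} \<Longrightarrow> 0 \<le> t i \<and> real_of_int (t i) \<le> \<epsilon> * real (card {l i..u i})"
    and le: "\<And>x. x \<in> carrier G \<Longrightarrow> cmod (\<phi> x) \<le> c" and c: "c \<ge> 0"
  shows "cmod (sum \<phi> B - (\<Sum>b\<in>B. \<phi> (b \<otimes> gap_shift G k a t)))
    \<le> 2 * c * (real k * \<epsilon> * real (card B))"
proof -
  let ?P = "\<Pi>\<^sub>E i\<in>{1..k}. {l i..u i}" and ?s = "gap_shift G k a t"
  let ?Y = "(\<lambda>b. b \<otimes> ?s) ` B"
  let ?bad = "{n \<in> ?P. (\<lambda>i\<in>{1..k}. n i + t i) \<notin> ?P}"
  have finP: "finite ?P"
    by (rule finite_PiE) auto
  then have finB: "finite B"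
    by (simp add: B)
  have Bc: "B \<subseteq> carrier G"
    using gap_elem_closed[OF a] by (auto simp: B)
  have s: "?s \<in> carrier G"
    by (rule gap_shift_closed[OF a])
  have inj': "inj_on (\<lambda>b. b \<otimes> ?s) B"
    by (rule inj_onI) (use Bc s in \<open>auto simp: subset_iff\<close>)
  have sub: "?Y - B \<subseteq> (\<lambda>n. gap_elem G k a n \<otimes> ?s) ` ?bad"
  proof
    fix y assume "y \<in> ?Y - B"
    then obtain n where n: "n \<in> ?P" "y = gap_elem G k a n \<otimes> ?s" "y \<notin> B"
      by (auto simp: B)
    then have "gap_elem G k a (\<lambda>i\<in>{1..k}. n i + t i) \<notin> B"
      by (simp only: gap_elem_add[OF a] not_False_eq_True)
    then have "(\<lambda>i\<in>{1..k}. n i + t i) \<notin> ?P"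
      unfolding B by blast
    then show "y \<in> (\<lambda>n. gap_elem G k a n \<otimes> ?s) ` ?bad"
      using n by blast
  qed
  have "finite ?bad"
    using finP by simp
  then have "card (?Y - B) \<le> card ?bad"
    using sub by (rule surj_card_le)
  then have card_le: "real (card (?Y - B)) \<le> real k * \<epsilon> * real (card B)"
    using card_box_translate_Diff_le[of "{1..k}" t \<epsilon> l u] t
    unfolding B card_image[OF inj] by fastforce
  have "cmod (sum \<phi> B - sum \<phi> ?Y) \<le> 2 * c * real (card (?Y - B))"
    by (rule norm_sum_diff_le_card_Diff)
      (use finB Bc s le inj' in \<open>auto simp: card_image\<close>)
  also have "\<dots> \<le> 2 * c * (real k * \<epsilon> * real (card B))"
    using card_le c by (intro mult_left_mono) auto
  finally show ?thesis
    by (simp add: sum.reindex[OF inj'] o_def)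
qed

text \<open>Adding the corner \<open>l\<close> embeds the box of shifts into the index box, so
  uniqueness of representations makes the shifts distinct. Each side of the shift box has at least
  \<open>\<epsilon>\<close> times the length of the corresponding interval because of the
  ceiling.\<close>

lemma (in comm_group) card_gap_shifts_ge:
  assumes a: "\<forall>i\<in>{0..k}. a i \<in> carrier G"
    and inj: "inj_on (gap_elem G k a) (\<Pi>\<^sub>E i\<in>{1..k}. {l i..u i})"
    and \<epsilon>: "0 \<le> \<epsilon>" "\<epsilon> \<le> 1"
  shows "\<epsilon> ^ k * real (card (\<Pi>\<^sub>E i\<in>{1..k}. {l i..u i}))
    \<le> real (card (gap_shift G k a ` (\<Pi>\<^sub>E i\<in>{1..k}. {0..<\<lceil>\<epsilon> * real (card {l i..u i})\<rceil>})))"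
proof -
  let ?T = "\<Pi>\<^sub>E i\<in>{1..k}. {0..<\<lceil>\<epsilon> * real (card {l i..u i})\<rceil>}"
  have mem: "(\<lambda>i\<in>{1..k}. l i + t i) \<in> (\<Pi>\<^sub>E i\<in>{1..k}. {l i..u i})" if t: "t \<in> ?T" for t
  proof (rule restrict_PiE_iff[THEN iffD2], intro ballI)
    fix i assume "i \<in> {1..k}"
    then have ti: "0 \<le> t i" "t i < \<lceil>\<epsilon> * real (card {l i..u i})\<rceil>"
      using t by (auto simp: PiE_iff)
    \<comment> \<open>With \<open>\<epsilon> \<le> 1\<close> the ceiling does not exceed the integer
      interval length, so \<open>l i + t i\<close> stays at most \<open>u i\<close>.\<close>
    have "\<epsilon> * real (card {l i..u i}) \<le> 1 * real (card {l i..u i})"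
      using \<epsilon> by (intro mult_right_mono) auto
    then have "\<lceil>\<epsilon> * real (card {l i..u i})\<rceil> \<le> int (card {l i..u i})"
      by (simp add: ceiling_le_iff del: card_atLeastAtMost_int)
    then show "l i + t i \<in> {l i..u i}"
      using ti by (auto split: if_splits)
  qed
  have "inj_on (gap_shift G k a) ?T"
  proof (rule inj_onI)
    fix t t' assume t: "t \<in> ?T" "t' \<in> ?T" and "gap_shift G k a t = gap_shift G k a t'"
    then have "gap_elem G k a (\<lambda>i\<in>{1..k}. l i + t i) = gap_elem G k a (\<lambda>i\<in>{1..k}. l i + t' i)"
      by (simp only: gap_elem_add[OF a])
    then have eq: "(\<lambda>i\<in>{1..k}. l i + t i) = (\<lambda>i\<in>{1..k}. l i + t' i)"
      using inj mem t by (meson inj_onD)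
    show "t = t'"
    proof (rule PiE_ext[OF t])
      fix i assume "i \<in> {1..k}"
      then show "t i = t' i"
        using fun_cong[OF eq, of i] by simp
    qed
  qed
  then have "real (card (gap_shift G k a ` ?T)) = (\<Prod>i\<in>{1..k}. real (nat \<lceil>\<epsilon> * real (card {l i..u i})\<rceil>))"
    by (simp add: card_image card_PiE)
  moreover have "(\<Prod>i\<in>{1..k}. \<epsilon> * real (card {l i..u i}))
      \<le> (\<Prod>i\<in>{1..k}. real (nat \<lceil>\<epsilon> * real (card {l i..u i})\<rceil>))"
    by (rule prod_mono) (use \<epsilon> in \<open>auto simp: real_nat_ceiling_ge simp del: card_atLeastAtMost_int\<close>)
  moreover have "(\<Prod>i\<in>{1..k}. \<epsilon> * real (card {l i..u i}))
      = \<epsilon> ^ k * real (card (\<Pi>\<^sub>E i\<in>{1..k}. {l i..u i}))"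
    by (simp add: prod.distrib card_PiE del: card_atLeastAtMost_int)
  ultimately show ?thesis
    by simp
qed

section \<open>Comparing the second moment with the contribution of small translations\<close>

theorem (in comm_group) proper_gap_sum_power_le:
  assumes fin: "finite (carrier G)" and gap: "proper_gap G k B"
    and large: "sqrt (real (order G)) \<le> real (card B)"
    and H: "condition_H G c \<phi>" and k: "k \<ge> 1" and c: "c \<ge> 1"
  shows "cmod (sum \<phi> B) ^ (k + 2)
    \<le> 8 * c ^ 3 * (4 * c * real k) ^ k * real (card B) ^ (k + 1) * sqrt (real (order G))"
proof -
  obtain a l u where a: "\<forall>i\<in>{0..k}. a i \<in> carrier G"
    and B: "B = gap_elem G k a ` (\<Pi>\<^sub>E i\<in>{1..k}. {l i..u i})"
    and inj: "inj_on (gap_elem G k a) (\<Pi>\<^sub>E i\<in>{1..k}. {l i..u i})"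
    using gap unfolding proper_gap_def by blast
  define S where "S = cmod (sum \<phi> B)"
  define N where "N = real (card B)"
  \<comment> \<open>Chosen to make the translation error
    \<open>2 * c * (real k * \<epsilon> * N)\<close> exactly \<open>S / 2\<close>. If
    \<open>S = 0\<close> then \<open>\<epsilon> = 0\<close> and \<open>T\<close> is empty, and the
    argument needs no case distinction.\<close>
  define \<epsilon> where "\<epsilon> = S / (4 * c * real k * N)"
  define T where "T = gap_shift G k a ` (\<Pi>\<^sub>E i\<in>{1..k}. {0..<\<lceil>\<epsilon> * real (card {l i..u i})\<rceil>})"
  note le = condition_HD(1)[OF H fin]
  have Bc: "B \<subseteq> carrier G"
    using gap_elem_closed[OF a] by (auto simp: B)
  have Tc: "T \<subseteq> carrier G"
    using gap_shift_closed[OF a] by (auto simp: T_def)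
  have "0 < order G"
    using fin by (simp add: order_gt_0_iff_finite)
  then have "0 < sqrt (real (order G))"
    by simp
  then have N: "N > 0"
    using large unfolding N_def by linarith
  have K: "4 * c * real k * N > 0"
    using c k N by simp
  \<comment> \<open>The trivial bound on \<open>S\<close> yields \<open>\<epsilon> \<le> 1\<close>,
    needed for counting the shifts.\<close>
  have "S \<le> N * c"
    unfolding S_def N_def by (rule sum_norm_bound) (use le Bc in auto)
  also have "\<dots> \<le> (4 * real k) * (N * c)"
    using mult_right_mono[of 1 "4 * real k" "N * c"] k c N by simp
  finally have \<epsilon>: "0 \<le> \<epsilon>" "\<epsilon> \<le> 1"
    using K by (auto simp: \<epsilon>_def S_def mult_ac)
  have S2: "(S / 2)\<^sup>2 \<le> (cmod (\<Sum>b\<in>B. \<phi> (b \<otimes> x)))\<^sup>2" if xT: "x \<in> T" for x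
  proof -
    obtain t where t: "t \<in> (\<Pi>\<^sub>E i\<in>{1..k}. {0..<\<lceil>\<epsilon> * real (card {l i..u i})\<rceil>})"
      and x: "x = gap_shift G k a t"
      using xT unfolding T_def by blast
    have "cmod (sum \<phi> B - (\<Sum>b\<in>B. \<phi> (b \<otimes> x))) \<le> 2 * c * (real k * \<epsilon> * N)"
      unfolding x N_def
    proof (rule norm_gap_sum_translate_diff_le[OF fin a B inj _ le])
      fix i assume "i \<in> {1..k}"
      then have "0 \<le> t i" "t i < \<lceil>\<epsilon> * real (card {l i..u i})\<rceil>"
        using t by (auto simp: PiE_iff)
      then show "0 \<le> t i \<and> real_of_int (t i) \<le> \<epsilon> * real (card {l i..u i})"
        by (auto simp: less_ceiling_iff simp del: card_atLeastAtMost_int)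
    qed (use c in auto)
    also have "\<dots> = S / 2"
      using c k N by (simp add: \<epsilon>_def field_simps)
    finally have "S / 2 \<le> cmod (\<Sum>b\<in>B. \<phi> (b \<otimes> x))"
      using norm_triangle_ineq2[of "sum \<phi> B" "\<Sum>b\<in>B. \<phi> (b \<otimes> x)"] by (simp add: S_def)
    then show ?thesis
      by (intro power_mono) (auto simp: S_def)
  qed
  have "\<epsilon> ^ k * N * (S / 2)\<^sup>2 \<le> real (card T) * (S / 2)\<^sup>2"
    using card_gap_shifts_ge[OF a inj \<epsilon>]
    unfolding N_def B card_image[OF inj] T_def by (intro mult_right_mono) simp_all
  also have "\<dots> = (\<Sum>x\<in>T. (S / 2)\<^sup>2)"
    by simp
  also have "\<dots> \<le> (\<Sum>x\<in>T. (cmod (\<Sum>b\<in>B. \<phi> (b \<otimes> x)))\<^sup>2)"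
    by (rule sum_mono) (rule S2)
  also have "\<dots> \<le> (\<Sum>x\<in>carrier G. (cmod (\<Sum>b\<in>B. \<phi> (b \<otimes> x)))\<^sup>2)"
    using fin Tc by (intro sum_mono2) auto
  also have "\<dots> \<le> 2 * c ^ 3 * N\<^sup>2 * sqrt (real (order G))"
    unfolding N_def by (rule second_moment_translates_le[OF fin Bc H c large])
  finally have main: "\<epsilon> ^ k * N * (S / 2)\<^sup>2 \<le> 2 * c ^ 3 * N\<^sup>2 * sqrt (real (order G))" .
  \<comment> \<open>The prefactor undoes the denominators in \<open>\<epsilon> ^ k\<close> and
    \<open>(S / 2)\<^sup>2\<close>; the surplus factor \<open>N\<close> is cancelled at the
    end.\<close>
  have "S ^ (k + 2) * N = 4 * (4 * c * real k * N) ^ k * (\<epsilon> ^ k * N * (S / 2)\<^sup>2)"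
    using c k N by (simp add: \<epsilon>_def power_divide power_add power2_eq_square)
  also have "\<dots> \<le> 4 * (4 * c * real k * N) ^ k * (2 * c ^ 3 * N\<^sup>2 * sqrt (real (order G)))"
    using main K by (intro mult_left_mono) auto
  also have "\<dots> = (8 * c ^ 3 * (4 * c * real k) ^ k * N ^ (k + 1) * sqrt (real (order G))) * N"
    by (simp add: power_mult_distrib power2_eq_square)
  finally show ?thesis
    using N unfolding S_def N_def by (rule mult_right_le_imp_le)
qed

section \<open>Cyclic groups and extraction of the root of order \<open>k + 2\<close>\<close>

theorem theorem4p1:
  fixes k :: nat and c :: real
  assumes "k \<ge> 1" and "c \<ge> 1"
  shows "\<exists>C::real. C > 0 \<and>
    (\<forall>(m::nat) (B::int set) (\<phi>::int \<Rightarrow> complex).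
      m \<ge> 1 \<longrightarrow>
      proper_gap (integer_mod_group m) k B \<longrightarrow>
      real (card B) \<ge> sqrt (real m) \<longrightarrow>
      condition_H (integer_mod_group m) c \<phi> \<longrightarrow>
      cmod (\<Sum>x\<in>B. \<phi> x)
        \<le> C * real (card B) powr (1 - 1 / (real k + 2)) * real m powr (1 / (2 * (real k + 2))) \<and>
      C * real (card B) powr (1 - 1 / (real k + 2)) * real m powr (1 / (2 * (real k + 2)))
        = C * real (card B) * (sqrt (real m) / real (card B)) powr (1 / (real k + 2)))"
proof -
  define K where "K = 8 * c ^ 3 * (4 * c * real k) ^ k"
  define C where "C = K powr (1 / (real k + 2))"
  have K: "K > 0"
    using assms by (simp add: K_def)
  show ?thesis
  proof (intro exI[of _ C] conjI allI impI)
    show "C > 0"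
      using K by (simp add: C_def)
  next
    fix m :: nat and B :: "int set" and \<phi> :: "int \<Rightarrow> complex"
    assume m: "m \<ge> 1" and gap: "proper_gap (integer_mod_group m) k B"
      and large: "real (card B) \<ge> sqrt (real m)" and H: "condition_H (integer_mod_group m) c \<phi>"
    interpret comm_group "integer_mod_group m"
      by (rule abelian_integer_mod_group)
    \<comment> \<open>Finiteness rests on \<open>m \<ge> 1\<close>:
      \<open>integer_mod_group 0\<close> is the infinite group of all integers.\<close>
    have fin: "finite (carrier (integer_mod_group m))" and ord: "order (integer_mod_group m) = m"
      using m by (auto simp: carrier_integer_mod_group order_def)
    let ?r = "1 / (real k + 2)" and ?N = "real (card B)" and ?S = "cmod (sum \<phi> B)"
    have N: "?N > 0"
      using large m real_sqrt_gt_zero[of "real m"] by linarith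
    have "?S ^ (k + 2) \<le> K * ?N ^ (k + 1) * sqrt (real m)"
      using proper_gap_sum_power_le[OF fin gap _ H assms] large unfolding ord K_def by simp
    then have "(?S ^ (k + 2)) powr ?r \<le> (K * ?N ^ (k + 1) * sqrt (real m)) powr ?r"
      by (intro powr_mono2) auto
    also have "(?S ^ (k + 2)) powr ?r = ?S"
    \<comment> \<open>\<open>powr_realpow\<close> needs a positive base; for \<open>?S = 0\<close>
      both sides are zero.\<close>
    proof (cases "?S = 0")
      case False
      then have "?S ^ (k + 2) = ?S powr real (k + 2)"
        by (intro powr_realpow[symmetric]) simp
      then have "(?S ^ (k + 2)) powr ?r = ?S powr (real (k + 2) * ?r)"
        by (simp only: powr_powr)
      also have "real (k + 2) * ?r = 1"
        by simp
      finally show ?thesis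
        by simp
    qed simp
    also have "(K * ?N ^ (k + 1) * sqrt (real m)) powr ?r
        = C * (?N ^ (k + 1)) powr ?r * sqrt (real m) powr ?r"
      by (simp only: C_def powr_mult)
    also have "(?N ^ (k + 1)) powr ?r = ?N powr (real (k + 1) * ?r)"
      using N by (simp only: powr_realpow[symmetric] powr_powr)
    also have "real (k + 1) * ?r = 1 - ?r"
      by (simp add: field_simps)
    also have sqrt_powr: "sqrt (real m) powr ?r = real m powr (1 / (2 * (real k + 2)))"
      by (simp add: powr_half_sqrt[symmetric] powr_powr)
    finally show "cmod (\<Sum>x\<in>B. \<phi> x) \<le> C * ?N powr (1 - ?r) * real m powr (1 / (2 * (real k + 2)))" .
    \<comment> \<open>For the second form of the bound, the factor \<open>?N\<close> is split off
      and the remaining negative power joins \<open>sqrt (real m)\<close> in a quotient.\<close>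
    have "?N powr (1 - ?r) = ?N / ?N powr ?r"
      using N by (simp add: powr_diff)
    moreover have "(sqrt (real m) / ?N) powr ?r = sqrt (real m) powr ?r / ?N powr ?r"
      by (simp add: powr_divide)
    ultimately show "C * ?N powr (1 - ?r) * real m powr (1 / (2 * (real k + 2)))
        = C * ?N * (sqrt (real m) / ?N) powr ?r"
      by (simp only: sqrt_powr[symmetric] times_divide_eq_right times_divide_eq_left)
  qed
qed

end
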